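(* Let $A\in\mathbb{C}^{n\times n}$ have index $k$ and satisfy $\operatorname{rank}(A^{\sim}AA^{\sim})=\operatorname{rank}(A)$. Then $A^{D,\mathfrak{m}}$ is the unique matrix $X\in\mathbb{C}^{n\times n}$ such that $$AX=P_{\mathcal{R}(A^{k}),\mathcal{N}(A^{k}A^{\mathfrak{m}})}\quad\text{and}\quad\mathcal{R}(X)\subseteq\mathcal{R}(A^{k}).$$
   Context: $\mathcal{R}(\cdot)$ and $\mathcal{N}(\cdot)$ denote range and null space. For subspaces with $\mathcal{S}\oplus\mathcal{T}=\mathbb{C}^n$, $P_{\mathcal{S},\mathcal{T}}$ is the projector onto $\mathcal{S}$ along $\mathcal{T}$. The index of $A\in\mathbb{C}^{n\times n}$ is the smallest nonnegative integer $k$ with $\operatorname{rank}(A^{k+1})=\operatorname{rank}(A^{k})$. The Minkowski metric matrix of order $n$ is $G=\operatorname{diag}(1,-I_{n-1})$. For $A\in\mathbb{C}^{n\times n}$, the Minkowski adjoint is $A^{\sim}=GA^{*}G$, where $A^*$ is the conjugate transpose. The Drazin inverse $A^{D}$ of $A$ (of index $k$) is the unique $X$ with $XAX=X$, $AX=XA$, $A^{k+1}X=A^{k}$. The Minkowski inverse $A^{\mathfrak{m}}$ is the unique matrix $X$ (if it exists) with $AXA=A$, $XAX=X$, $(AX)^{\sim}=AX$, $(XA)^{\sim}=XA$; it exists if and only if $\operatorname{rank}(A^{\sim}AA^{\sim})=\operatorname{rank}(A)$. When it exists, the $\mathfrak{m}$-DMP inverse of $A$ is $A^{D,\mathfrak{m}}=A^{D}AA^{\mathfrak{m}}$.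 *)

theory Defs
  imports
    "Jordan_Normal_Form.DL_Rank"
    "Jordan_Normal_Form.Matrix_Kernel"
    "Jordan_Normal_Form.Schur_Decomposition"
begin

text \<open>
  Matrices are \<open>complex mat\<close>, so that the order \<open>n\<close> is an ordinary natural number and the
  first coordinate (index \<open>0\<close>) is available for the Minkowski metric.  The definitions below
  are meant for square matrices; their order is then read off as \<open>dim_row A\<close>.
\<close>

definition mat_range :: "complex mat \<Rightarrow> complex vec set" where
  "mat_range A = (\<lambda>v. A *\<^sub>v v) ` carrier_vec (dim_col A)"

definition mat_rank :: "complex mat \<Rightarrow> nat" where
  "mat_rank A = vec_space.rank (dim_row A) A"

definition mat_index :: "complex mat \<Rightarrow> nat" where
  "mat_index A = (LEAST k. mat_rank (A ^\<^sub>m (k + 1)) = mat_rank (A ^\<^sub>m k))"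

definition complementary_subspaces :: "nat \<Rightarrow> complex vec set \<Rightarrow> complex vec set \<Rightarrow> bool" where
  "complementary_subspaces n S T \<longleftrightarrow>
     VectorSpace.subspace class_ring S (module_vec TYPE(complex) n) \<and>
     VectorSpace.subspace class_ring T (module_vec TYPE(complex) n) \<and>
     S \<inter> T = {0\<^sub>v n} \<and>
     {s + t | s t. s \<in> S \<and> t \<in> T} = carrier_vec n"

text \<open>
  Only meaningful if \<open>complementary_subspaces n S T\<close>; otherwise the description denotes nothing.
\<close>

definition projector :: "nat \<Rightarrow> complex vec set \<Rightarrow> complex vec set \<Rightarrow> complex mat" where
  "projector n S T =
     (THE P. P \<in> carrier_mat n n \<and> P * P = P \<and> mat_range P = S \<and> mat_kernel P = T)"

definition minkowski_metric :: "nat \<Rightarrow> complex mat" where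
  "minkowski_metric n = mat_diag n (\<lambda>i. if i = 0 then 1 else - 1)"

definition minkowski_adjoint :: "complex mat \<Rightarrow> complex mat" where
  "minkowski_adjoint A =
     minkowski_metric (dim_row A) * mat_adjoint A * minkowski_metric (dim_row A)"

definition is_drazin_inverse :: "complex mat \<Rightarrow> complex mat \<Rightarrow> bool" where
  "is_drazin_inverse A X \<longleftrightarrow>
     X \<in> carrier_mat (dim_row A) (dim_row A) \<and>
     X * A * X = X \<and> A * X = X * A \<and>
     A ^\<^sub>m (mat_index A + 1) * X = A ^\<^sub>m (mat_index A)"

definition drazin_inverse :: "complex mat \<Rightarrow> complex mat" where
  "drazin_inverse A = (THE X. is_drazin_inverse A X)"

definition is_minkowski_inverse :: "complex mat \<Rightarrow> complex mat \<Rightarrow> bool" where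
  "is_minkowski_inverse A X \<longleftrightarrow>
     X \<in> carrier_mat (dim_row A) (dim_row A) \<and>
     A * X * A = A \<and> X * A * X = X \<and>
     minkowski_adjoint (A * X) = A * X \<and>
     minkowski_adjoint (X * A) = X * A"

text \<open>
  Need not exist; for square \<open>A\<close> it does iff \<open>mat_rank (A\<^sup>\<sim> * A * A\<^sup>\<sim>) = mat_rank A\<close>, where
  \<open>A\<^sup>\<sim>\<close> is \<open>minkowski_adjoint A\<close>.
\<close>

definition minkowski_inverse :: "complex mat \<Rightarrow> complex mat" where
  "minkowski_inverse A = (THE X. is_minkowski_inverse A X)"

definition m_DMP_inverse :: "complex mat \<Rightarrow> complex mat" where
  "m_DMP_inverse A = drazin_inverse A * A * minkowski_inverse A"

end

theory Submission
  imports Defs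
begin

text \<open>
  Let \<open>k\<close> be the index of \<open>A\<close>, \<open>D = A ^\<^sub>m k\<close>, \<open>E\<close> the Drazin inverse and \<open>M\<close> the Minkowski inverse.

  Both inverses are instances of one notion, the inverse of \<open>A\<close> along a matrix \<open>B\<close>: a matrix \<open>X\<close> with
  \<open>X * A * B = B = B * A * X\<close> that is both a right and a left multiple of \<open>B\<close>.  It is unique, and it
  exists as soon as \<open>B * A * B\<close> has the rank of \<open>B\<close>, because equality of ranks lets \<open>B\<close> be recovered from
  \<open>B * A * B\<close> by a factor on either side (\<open>is_inverse_along_unique\<close>, \<open>is_inverse_along_exists\<close>).  The
  Drazin inverse is the inverse along \<open>D\<close>, where the rank criterion holds because the ranks of the powers
  are constant from the index on (\<open>is_drazin_inverse_iff_inverse_along\<close>,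
  \<open>rank_sandwiched_by_index_power\<close>); the Minkowski inverse is the inverse along the Minkowski adjoint,
  where the criterion is the rank hypothesis (\<open>is_minkowski_inverse_iff_inverse_along\<close>).

  Now \<open>E\<close> is a left and a right multiple of \<open>D\<close>, \<open>E * A * D = D\<close>, and \<open>A * M * A = A\<close>.  For
  \<open>P = A * (E * A * M)\<close> this gives \<open>P * D = D\<close>, that \<open>P\<close> is a right multiple of \<open>D\<close>, and that \<open>P\<close> and
  \<open>D * M\<close> are left multiples of each other.  Hence \<open>P\<close> is idempotent with the range of \<open>D\<close> and the null
  space of \<open>D * M\<close>, and an idempotent is the projector onto its range along its null space
  (\<open>projector_range_kernel_idempotent\<close>).  A matrix \<open>X\<close> with range in that of \<open>D\<close> satisfies
  \<open>E * A * X = X\<close>, so \<open>A * X = P\<close> forces \<open>X = E * P = E * A * M\<close>.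
\<close>

section \<open>Ranges, ranks and factorizations\<close>

lemma mat_range_eq_span:
  assumes A: "A \<in> carrier_mat n m"
  shows "mat_range A =
    LinearCombinations.module.span class_ring (module_vec TYPE(complex) n) (set (cols A))"
proof -
  interpret vec_space "TYPE(complex)" n .
  show ?thesis
    using A col_space_eq[OF A] unfolding col_space_def mat_range_def by auto
qed

text \<open>
  The columns of \<open>A\<close> are values of \<open>A\<close>, hence of \<open>C\<close>; preimages of them under \<open>C\<close> are
  the columns of \<open>F\<close>.  Every inclusion of ranges enters the matrix calculations below in this form.
\<close>

lemma range_subset_imp_factor:
  assumes A: "A \<in> carrier_mat n m" and C: "C \<in> carrier_mat n r"
    and sub: "mat_range A \<subseteq> mat_range C"
  shows "\<exists>F \<in> carrier_mat r m. A = C * F"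
proof -
  have "\<exists>x. x \<in> carrier_vec r \<and> C *\<^sub>v x = col A j" if j: "j < m" for j
  proof -
    have "A *\<^sub>v unit_vec m j = col A j"
      using A j by (intro eq_vecI) auto
    then have "col A j \<in> mat_range A"
      using A j unfolding mat_range_def by (metis carrier_matD(2) imageI unit_vec_carrier)
    then have "col A j \<in> mat_range C" using sub by blast
    then show ?thesis using C unfolding mat_range_def by auto
  qed
  then obtain f where f: "\<And>j. j < m \<Longrightarrow> f j \<in> carrier_vec r \<and> C *\<^sub>v f j = col A j"
    by metis
  define F where "F = mat_of_cols r (map f [0..<m])"
  have F: "F \<in> carrier_mat r m" unfolding F_def by auto
  have "A = C * F"
  proof (rule eq_matI)
    fix i j assume i: "i < dim_row (C * F)" and j: "j < dim_col (C * F)"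
    then have ij: "i < n" "j < m" using C F by auto
    have "col F j = f j" using ij f unfolding F_def by simp
    then have "(C * F) $$ (i, j) = (C *\<^sub>v f j) $ i" using C F ij by simp
    also have "\<dots> = A $$ (i, j)" using f ij A by simp
    finally show "A $$ (i, j) = (C * F) $$ (i, j)" by simp
  qed (use A C F in auto)
  then show ?thesis using F by blast
qed

lemma mat_range_mult_subset:
  assumes "C \<in> carrier_mat n r" "F \<in> carrier_mat r m"
  shows "mat_range (C * F) \<subseteq> mat_range C"
proof -
  have "(C * F) *\<^sub>v v = C *\<^sub>v (F *\<^sub>v v)" if "v \<in> carrier_vec m" for v
    using assms that by (rule assoc_mult_mat_vec)
  then show ?thesis using assms unfolding mat_range_def by auto
qed

lemma range_subset_imp_rank_le:
  assumes A: "A \<in> carrier_mat n m" and C: "C \<in> carrier_mat n r"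
    and sub: "mat_range A \<subseteq> mat_range C"
  shows "mat_rank A \<le> mat_rank C"
    and "mat_rank A = mat_rank C \<Longrightarrow> mat_range A = mat_range C"
proof -
  interpret vec_space "TYPE(complex)" n .
  let ?SA = "span (set (cols A))" and ?SC = "span (set (cols C))"
  have cA: "set (cols A) \<subseteq> carrier_vec n" and cC: "set (cols C) \<subseteq> carrier_vec n"
    using A C cols_dim by fastforce+
  have sub': "?SA \<subseteq> ?SC"
    using sub mat_range_eq_span[OF A] mat_range_eq_span[OF C] by simp
  have subC: "VectorSpace.subspace class_ring ?SC V" and subA: "VectorSpace.subspace class_ring ?SA V"
    using cA cC span_is_subspace by auto
  interpret W: vectorspace class_ring "vs ?SC"
    using subC by (rule subspace_is_vs)
  have finC: "W.fin_dim" using fin_dim_span cC by auto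
  have finA: "vectorspace.fin_dim class_ring (vs ?SA)" using fin_dim_span cA by auto
  have nest: "VectorSpace.subspace class_ring ?SA (vs ?SC)"
    using nested_subspaces[OF subC subA sub'] .
  have ranks: "mat_rank A = vectorspace.dim class_ring (vs ?SA)"
    "mat_rank C = W.dim"
    using A C unfolding mat_rank_def by (auto simp: rank_def)
  show "mat_rank A \<le> mat_rank C"
    unfolding ranks using W.subspace_dim[OF nest finC] finA by simp
  assume eq: "mat_rank A = mat_rank C"
  obtain S where S: "maximal S (\<lambda>T. T \<subseteq> set (cols A) \<and> lin_indpt T)" "finite S"
    using maximal_exists_superset[of "set (cols A)" "\<lambda>T. T \<subseteq> set (cols A) \<and> lin_indpt T" "{}"]
    by (auto simp: lin_dep_def)
  have SA: "S \<subseteq> set (cols A)" and li: "lin_indpt S" using S(1) by (auto simp: maximal_def)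
  have card: "card S = W.dim"
    using rank_card_indpt[OF A S(1)] eq ranks A unfolding mat_rank_def by simp
  have SC: "S \<subseteq> ?SC" using SA sub' in_own_span[OF cA] by blast
  have li': "W.lin_indpt S"
    using span_li_not_depend(2)[OF SC span_is_submodule[OF cC]] li by simp
  have "W.basis S" using W.dim_li_is_basis[OF finC S(2) _ li'] SC card by simp
  then have "W.span S = ?SC" unfolding W.basis_def by simp
  then have "span S = ?SC"
    using span_li_not_depend(1)[OF SC span_is_submodule[OF cC]] by simp
  moreover have "span S \<subseteq> ?SA" using SA span_is_monotone by blast
  ultimately show "mat_range A = mat_range C"
    using sub mat_range_eq_span[OF A] mat_range_eq_span[OF C] by auto
qed

text \<open>
  A basis of the range of \<open>A\<close>, written as the columns of \<open>C\<close>.  Since a product with inner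
  dimension \<open>r\<close> has rank at most \<open>r\<close>, this makes the rank the least possible inner dimension, a
  description that is visibly symmetric under the adjoint.
\<close>

lemma rank_factorization:
  assumes A: "A \<in> carrier_mat n m"
  obtains C F where "C \<in> carrier_mat n (mat_rank A)" "F \<in> carrier_mat (mat_rank A) m" "A = C * F"
proof -
  interpret vec_space "TYPE(complex)" n .
  have cA: "set (cols A) \<subseteq> carrier_vec n" using A cols_dim by fastforce
  have sub: "VectorSpace.subspace class_ring (span (set (cols A))) V" using cA span_is_subspace by auto
  interpret W: vectorspace class_ring "vs (span (set (cols A)))"
    using sub by (rule subspace_is_vs)
  have "W.fin_dim" using fin_dim_span cA by auto
  then obtain S where S: "finite S" "W.basis S" using W.finite_basis_exists by blast
  have SA: "S \<subseteq> span (set (cols A))" and sp: "W.span S = span (set (cols A))"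
    using S(2) unfolding W.basis_def by auto
  have sp': "span S = span (set (cols A))"
    using sp span_li_not_depend(1)[OF SA span_is_submodule[OF cA]] by simp
  have "mat_rank A = W.dim" using A unfolding mat_rank_def by (simp add: rank_def)
  then have card: "card S = mat_rank A" using W.dim_basis[OF S] by simp
  obtain xs where xs: "set xs = S" "distinct xs" using finite_distinct_list[OF S(1)] by blast
  have len: "length xs = mat_rank A" using xs card distinct_card by metis
  have Sn: "S \<subseteq> carrier_vec n" using SA span_is_subset2[OF cA] by auto
  define C where "C = mat_of_cols n xs"
  have C: "C \<in> carrier_mat n (mat_rank A)" unfolding C_def using len by auto
  have "set (cols C) = S" unfolding C_def using xs Sn by simp
  then have "mat_range A \<subseteq> mat_range C"
    using mat_range_eq_span[OF A] mat_range_eq_span[OF C] sp' by simp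
  from range_subset_imp_factor[OF A C this] show thesis using that C by blast
qed

lemma mat_rank_mult_le:
  assumes M: "M \<in> carrier_mat n r" and N: "N \<in> carrier_mat r m"
  shows "mat_rank (M * N) \<le> mat_rank M" and "mat_rank (M * N) \<le> r"
    and "mat_rank (M * N) \<le> mat_rank N"
proof -
  have 1: "mat_rank (M * N) \<le> mat_rank M"
    if "M \<in> carrier_mat n r" "N \<in> carrier_mat r m" for M N n r m
    using range_subset_imp_rank_le(1)[OF mult_carrier_mat[OF that] that(1) mat_range_mult_subset[OF that]] .
  show "mat_rank (M * N) \<le> mat_rank M" using 1 M N .
  have 2: "mat_rank (M * N) \<le> r"
    if MN: "M \<in> carrier_mat n r" "N \<in> carrier_mat r m" for M N n r m
  proof -
    interpret vec_space "TYPE(complex)" n .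
    have "mat_rank M \<le> r" using rank_le_nc[OF MN(1)] MN unfolding mat_rank_def by auto
    then show ?thesis using 1[OF MN] by simp
  qed
  show "mat_rank (M * N) \<le> r" using 2 M N .
  obtain C F where CF: "C \<in> carrier_mat r (mat_rank N)" "F \<in> carrier_mat (mat_rank N) m" "N = C * F"
    using rank_factorization[OF N] .
  have "M * N = (M * C) * F"
    unfolding CF(3) by (rule assoc_mult_mat[OF M CF(1,2), symmetric])
  then show "mat_rank (M * N) \<le> mat_rank N"
    using 2[OF mult_carrier_mat[OF M CF(1)] CF(2)] by metis
qed

section \<open>The conjugate transpose\<close>

lemma mat_adjoint_index:
  "i < dim_col A \<Longrightarrow> j < dim_row A \<Longrightarrow> mat_adjoint A $$ (i, j) = cnj (A $$ (j, i))"
  unfolding mat_adjoint_def by (simp add: mat_of_rows_index)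

lemma mat_adjoint_carrier:
  "A \<in> carrier_mat n m \<Longrightarrow> mat_adjoint A \<in> carrier_mat m n"
  unfolding mat_adjoint_def by auto

lemma mat_adjoint_involution [simp]: "mat_adjoint (mat_adjoint A) = (A :: complex mat)"
  by (rule eq_matI) (auto simp: mat_adjoint_index mat_adjoint_def mat_of_rows_index)

lemma mat_adjoint_mult:
  fixes M :: "complex mat"
  assumes M: "M \<in> carrier_mat n r" and N: "N \<in> carrier_mat r m"
  shows "mat_adjoint (M * N) = mat_adjoint N * mat_adjoint M"
proof (rule eq_matI)
  have adj: "mat_adjoint (M * N) \<in> carrier_mat m n" "mat_adjoint M \<in> carrier_mat r n"
    "mat_adjoint N \<in> carrier_mat m r"
    using M N by (auto intro!: mat_adjoint_carrier)
  then show "dim_row (mat_adjoint (M * N)) = dim_row (mat_adjoint N * mat_adjoint M)"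
    "dim_col (mat_adjoint (M * N)) = dim_col (mat_adjoint N * mat_adjoint M)"
    by auto
  fix i j assume "i < dim_row (mat_adjoint N * mat_adjoint M)" "j < dim_col (mat_adjoint N * mat_adjoint M)"
  then have ij: "i < m" "j < n" using adj by auto
  have "mat_adjoint (M * N) $$ (i, j) = cnj ((M * N) $$ (j, i))"
    using ij M N by (intro mat_adjoint_index) auto
  also have "\<dots> = (\<Sum>l<r. cnj (M $$ (j, l)) * cnj (N $$ (l, i)))"
    using ij M N by (simp add: scalar_prod_def atLeast0LessThan)
  also have "\<dots> = (\<Sum>l<r. mat_adjoint N $$ (i, l) * mat_adjoint M $$ (l, j))"
    using ij M N by (intro sum.cong) (auto simp: mat_adjoint_index)
  also have "\<dots> = (mat_adjoint N * mat_adjoint M) $$ (i, j)"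
    using ij adj by (simp add: scalar_prod_def atLeast0LessThan)
  finally show "mat_adjoint (M * N) $$ (i, j) = (mat_adjoint N * mat_adjoint M) $$ (i, j)" .
qed

text \<open>
  The adjoint turns a factorization of \<open>A\<close> through \<open>r\<close> dimensions into one of its adjoint through
  \<open>r\<close> dimensions, so neither rank exceeds the other.
\<close>

lemma mat_rank_adjoint:
  assumes A: "A \<in> carrier_mat n m"
  shows "mat_rank (mat_adjoint A) = mat_rank A"
proof -
  have le: "mat_rank (mat_adjoint B) \<le> mat_rank B" if B: "B \<in> carrier_mat p q" for B p q
  proof -
    obtain C F where CF: "C \<in> carrier_mat p (mat_rank B)" "F \<in> carrier_mat (mat_rank B) q" "B = C * F"
      using rank_factorization[OF B] .
    have "mat_adjoint B = mat_adjoint F * mat_adjoint C"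
      using CF(3) mat_adjoint_mult[OF CF(1,2)] by simp
    then show ?thesis
      using mat_rank_mult_le(2)[OF mat_adjoint_carrier[OF CF(2)] mat_adjoint_carrier[OF CF(1)]] by simp
  qed
  show ?thesis using le[OF A] le[OF mat_adjoint_carrier[OF A]] by simp
qed

lemma rank_mult_eq_imp_right_factor:
  assumes M: "M \<in> carrier_mat n r" and N: "N \<in> carrier_mat r m"
    and eq: "mat_rank (M * N) = mat_rank M"
  obtains Y where "Y \<in> carrier_mat m r" "M = M * N * Y"
proof -
  have MN: "M * N \<in> carrier_mat n m" using M N by simp
  have "mat_range (M * N) = mat_range M"
    using range_subset_imp_rank_le(2)[OF MN M mat_range_mult_subset[OF M N] eq] .
  then have "mat_range M \<subseteq> mat_range (M * N)" by simp
  from range_subset_imp_factor[OF M MN this] show thesis using that by blast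
qed

text \<open>
  The adjoint of the right-hand version; this is where equality of row rank and column rank enters.
\<close>

lemma rank_mult_eq_imp_left_factor:
  assumes M: "M \<in> carrier_mat n r" and N: "N \<in> carrier_mat r m"
    and eq: "mat_rank (M * N) = mat_rank N"
  obtains Z where "Z \<in> carrier_mat r n" "N = Z * (M * N)"
proof -
  have MN: "M * N \<in> carrier_mat n m" using M N by simp
  note adj = mat_adjoint_carrier[OF N] mat_adjoint_carrier[OF M]
  note MN_adj = mat_adjoint_mult[OF M N]
  have "mat_rank (mat_adjoint N * mat_adjoint M) = mat_rank (mat_adjoint N)"
    using eq mat_rank_adjoint[OF MN] mat_rank_adjoint[OF N] unfolding MN_adj by metis
  from rank_mult_eq_imp_right_factor[OF adj this]
  obtain Y where Y: "Y \<in> carrier_mat n r" "mat_adjoint N = mat_adjoint N * mat_adjoint M * Y" .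
  have "N = mat_adjoint (mat_adjoint (M * N) * Y)"
    unfolding MN_adj Y(2)[symmetric] by (rule mat_adjoint_involution[symmetric])
  also have "\<dots> = mat_adjoint Y * (M * N)"
    unfolding mat_adjoint_mult[OF mat_adjoint_carrier[OF MN] Y(1)] by simp
  finally show thesis using that mat_adjoint_carrier[OF Y(1)] by blast
qed


section \<open>The inverse along a matrix\<close>

text \<open>
  Mary's inverse of \<open>A\<close> along \<open>D\<close>.  The two factorizations of \<open>X\<close> say that the range of \<open>X\<close> lies in
  that of \<open>D\<close> and that the null space of \<open>X\<close> contains that of \<open>D\<close>.
\<close>

definition is_inverse_along :: "complex mat \<Rightarrow> complex mat \<Rightarrow> complex mat \<Rightarrow> bool" where
  "is_inverse_along A D X \<longleftrightarrow>
     X \<in> carrier_mat (dim_row A) (dim_row A) \<and> X * A * D = D \<and> D * A * X = D \<and>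
     (\<exists>Y \<in> carrier_mat (dim_row A) (dim_row A). X = D * Y) \<and>
     (\<exists>Z \<in> carrier_mat (dim_row A) (dim_row A). X = Z * D)"

lemma is_inverse_alongE:
  assumes "is_inverse_along A D X" and "A \<in> carrier_mat n n"
  obtains Y Z where "X \<in> carrier_mat n n" "X * A * D = D" "D * A * X = D"
    "Y \<in> carrier_mat n n" "X = D * Y" "Z \<in> carrier_mat n n" "X = Z * D"
proof -
  have dim: "dim_row A = n" using assms(2) by simp
  show thesis using assms(1) that unfolding is_inverse_along_def dim by blast
qed

text \<open>
  Both candidates equal \<open>X1 * A * X2\<close>: a left factorization of \<open>X1\<close> is paired with \<open>D * A * X2 = D\<close>,
  a right factorization of \<open>X2\<close> with \<open>X1 * A * D = D\<close>.
\<close>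

lemma is_inverse_along_unique:
  assumes A: "A \<in> carrier_mat n n" and D: "D \<in> carrier_mat n n"
    and X1: "is_inverse_along A D X1" and X2: "is_inverse_along A D X2"
  shows "X1 = X2"
proof -
  note assoc = assoc_mult_mat[of _ n n _ n _ n] mult_carrier_mat[of _ n n _ n]
  from X1 A obtain Z where Z: "Z \<in> carrier_mat n n" "X1 = Z * D" and X1': "X1 \<in> carrier_mat n n" "X1 * A * D = D"
    by (elim is_inverse_alongE)
  from X2 A obtain Y where Y: "Y \<in> carrier_mat n n" "X2 = D * Y" and X2': "X2 \<in> carrier_mat n n" "D * A * X2 = D"
    by (elim is_inverse_alongE)
  have "X1 = Z * (D * A * X2)" using Z X2' by simp
  also have "\<dots> = Z * D * A * X2" using Z A D X2' by (simp add: assoc)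
  also have "\<dots> = X1 * A * X2" by (simp only: Z(2))
  also have "\<dots> = X1 * A * (D * Y)" by (simp only: Y(2))
  also have "\<dots> = X1 * A * D * Y" using X1'(1) A D Y(1) by (simp add: assoc)
  also have "\<dots> = X2" by (simp only: X1'(2) Y(2))
  finally show ?thesis .
qed

lemma is_inverse_along_outer:
  assumes A: "A \<in> carrier_mat n n" and D: "D \<in> carrier_mat n n"
    and X: "is_inverse_along A D X"
  shows "X * A * X = X"
proof -
  note assoc = assoc_mult_mat[of _ n n _ n _ n] mult_carrier_mat[of _ n n _ n]
  from X A obtain Y where Y: "Y \<in> carrier_mat n n" "X = D * Y" and X': "X \<in> carrier_mat n n" "X * A * D = D"
    by (elim is_inverse_alongE)
  have "X * A * X = X * A * (D * Y)" by (simp only: Y(2)[symmetric])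
  also have "\<dots> = X * A * D * Y" using X'(1) A D Y(1) by (simp add: assoc)
  also have "\<dots> = X" using X'(2) Y by simp
  finally show ?thesis .
qed

text \<open>
  Equality of ranks yields \<open>D = D * A * D * Y\<close> and \<open>D = Z * D * A * D\<close>.  Inserting the first equation
  into \<open>Z * D\<close> gives \<open>Z * D = D * Y\<close>, and this common value is the inverse.
\<close>

lemma is_inverse_along_exists:
  assumes A: "A \<in> carrier_mat n n" and D: "D \<in> carrier_mat n n"
    and rank: "mat_rank (D * A * D) = mat_rank D"
  shows "\<exists>X. is_inverse_along A D X"
proof -
  note assoc = assoc_mult_mat[of _ n n _ n _ n] mult_carrier_mat[of _ n n _ n]
  have AD: "A * D \<in> carrier_mat n n" and DA: "D * A \<in> carrier_mat n n" using A D by auto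
  have DAD: "D * A * D = D * (A * D)" using A D by (simp add: assoc)
  obtain Y where Y: "Y \<in> carrier_mat n n" "D = D * (A * D) * Y"
    using rank_mult_eq_imp_right_factor[OF D AD rank[unfolded DAD]] .
  obtain Z where Z: "Z \<in> carrier_mat n n" "D = Z * (D * A * D)"
    using rank_mult_eq_imp_left_factor[OF DA D rank] .
  have "Z * D = Z * (D * (A * D) * Y)" by (simp only: Y(2)[symmetric])
  also have "\<dots> = Z * (D * A * D) * Y" using A D Y(1) Z(1) by (simp add: assoc)
  also have "\<dots> = D * Y" by (simp only: Z(2)[symmetric])
  finally have ZY: "Z * D = D * Y" .
  have "Z * D * A * D = D" using Z A D by (simp add: assoc)
  moreover have "D * A * (Z * D) = D" unfolding ZY using Y A D by (simp add: assoc)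
  ultimately have "is_inverse_along A D (Z * D)"
    unfolding is_inverse_along_def using A D Y(1) Z(1) ZY by (auto intro: bexI[of _ Y] bexI[of _ Z])
  then show ?thesis by blast
qed

section \<open>The Drazin inverse as the inverse along a power\<close>

lemma pow_mat_add:
  assumes A: "A \<in> carrier_mat n n"
  shows "A ^\<^sub>m (i + j) = A ^\<^sub>m i * A ^\<^sub>m j"
proof (induction j)
  case 0
  then show ?case using A by simp
next
  case (Suc j)
  then show ?case using A by (simp add: assoc_mult_mat[of _ n n _ n _ n] mult_carrier_mat[of _ n n _ n])
qed

lemma pow_mat_commute:
  assumes A: "A \<in> carrier_mat n n" and X: "X \<in> carrier_mat n n" and comm: "A * X = X * A"
  shows "A ^\<^sub>m k * X = X * A ^\<^sub>m k"
proof (induction k)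
  case 0
  then show ?case using A X by simp
next
  case (Suc k)
  have "A ^\<^sub>m Suc k * X = A ^\<^sub>m k * (A * X)" using A X by (simp add: assoc_mult_mat[of _ n n _ n _ n] mult_carrier_mat[of _ n n _ n])
  also have "\<dots> = A ^\<^sub>m k * X * A" using A X comm by (simp add: assoc_mult_mat[of _ n n _ n _ n] mult_carrier_mat[of _ n n _ n])
  also have "\<dots> = X * A ^\<^sub>m Suc k" using A X Suc by (simp add: assoc_mult_mat[of _ n n _ n _ n] mult_carrier_mat[of _ n n _ n])
  finally show ?case .
qed

text \<open>
  The index is defined as a least element; the ranks of the powers cannot decrease for ever, so the
  set in question is nonempty.
\<close>

lemma mat_index_rank:
  assumes A: "A \<in> carrier_mat n n"
  shows "mat_rank (A ^\<^sub>m (mat_index A + 1)) = mat_rank (A ^\<^sub>m mat_index A)"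
proof -
  let ?r = "\<lambda>k. mat_rank (A ^\<^sub>m k)"
  have mono: "?r (k + 1) \<le> ?r k" for k
    using mat_rank_mult_le(1)[of "A ^\<^sub>m k" n n A n] A by simp
  have "\<exists>k. ?r (k + 1) = ?r k"
  proof (rule ccontr)
    assume "\<nexists>k. ?r (k + 1) = ?r k"
    then have strict: "?r (k + 1) < ?r k" for k using mono[of k] by (metis le_neq_implies_less)
    have "?r k + k \<le> ?r 0" for k
    proof (induction k)
      case (Suc k)
      then show ?case using strict[of k] by simp
    qed simp
    from this[of "Suc (?r 0)"] show False by simp
  qed
  then show ?thesis unfolding mat_index_def by (rule LeastI_ex)
qed

text \<open>
  One stabilization step \<open>D = D * A * Y\<close> at the index propagates: iterating it gives a factorization
  \<open>D = D * A ^\<^sub>m j * W\<close> for every \<open>j\<close>.  The exponent \<open>1 + mat_index A\<close> reaches \<open>D * A * D\<close>.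
\<close>

lemma rank_sandwiched_by_index_power:
  assumes A: "A \<in> carrier_mat n n"
  defines "D \<equiv> A ^\<^sub>m mat_index A"
  shows "mat_rank (D * A * D) = mat_rank D"
proof -
  note assoc = assoc_mult_mat[of _ n n _ n _ n] mult_carrier_mat[of _ n n _ n]
  have D: "D \<in> carrier_mat n n" unfolding D_def using A by simp
  have "mat_rank (D * A) = mat_rank D"
    using mat_index_rank[OF A] unfolding D_def by simp
  then obtain Y where Y: "Y \<in> carrier_mat n n" "D = D * A * Y"
    using rank_mult_eq_imp_right_factor[OF D A] by metis
  have AD: "A ^\<^sub>m j * D = D * A ^\<^sub>m j" for j
    using pow_mat_add[OF A, of j "mat_index A"] pow_mat_add[OF A, of "mat_index A" j]
    unfolding D_def by (simp add: add.commute)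
  have "\<exists>W \<in> carrier_mat n n. D = D * A ^\<^sub>m j * W" for j
  proof (induction j)
    case 0
    show ?case using D A by (intro bexI[of _ "1\<^sub>m n"]) auto
  next
    case (Suc j)
    then obtain W where W: "W \<in> carrier_mat n n" "D = D * A ^\<^sub>m j * W" by blast
    have "D = A ^\<^sub>m j * (D * A * Y) * W"
      by (simp only: Y(2)[symmetric] AD W(2)[symmetric])
    also have "\<dots> = A ^\<^sub>m j * D * A * (Y * W)" using A D Y(1) W(1) by (simp add: assoc)
    also have "\<dots> = D * A ^\<^sub>m Suc j * (Y * W)" unfolding AD using A D Y(1) W(1) by (simp add: assoc)
    finally show ?case using Y(1) W(1) by (meson mult_carrier_mat)
  qed
  then obtain W where W: "W \<in> carrier_mat n n" "D = D * A ^\<^sub>m (1 + mat_index A) * W" by blast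
  have "D * A ^\<^sub>m (1 + mat_index A) = D * A * D"
    unfolding pow_mat_add[OF A] using A D by (simp add: assoc D_def)
  then have "mat_rank D \<le> mat_rank (D * A * D)"
    using mat_rank_mult_le(1)[of "D * A * D" n n W n] W A D by (metis mult_carrier_mat)
  moreover have "mat_rank (D * A * D) \<le> mat_rank D"
    using mat_rank_mult_le(3)[of "D * A" n n D n] A D by simp
  ultimately show ?thesis by simp
qed

text \<open>
  A Drazin inverse \<open>X\<close> commutes with \<open>A\<close>, so \<open>X = X * A * X\<close> can be expanded to show powers of \<open>A\<close> on
  either side of \<open>X\<close>.  Conversely, since powers of \<open>A\<close> commute with \<open>A\<close>, both \<open>A * X\<close> and \<open>X * A\<close> reduce to
  \<open>X * A * A * X\<close>, and \<open>X\<close> commutes with \<open>A\<close>.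
\<close>

lemma is_drazin_inverse_iff_inverse_along:
  assumes A: "A \<in> carrier_mat n n"
  shows "is_drazin_inverse A X \<longleftrightarrow> is_inverse_along A (A ^\<^sub>m mat_index A) X"
proof -
  note assoc = assoc_mult_mat[of _ n n _ n _ n] mult_carrier_mat[of _ n n _ n]
  define D where "D = A ^\<^sub>m mat_index A"
  have D: "D \<in> carrier_mat n n" unfolding D_def using A by simp
  have pow: "A ^\<^sub>m (mat_index A + 1) = D * A" unfolding D_def by simp
  have comm: "D * A = A * D" unfolding D_def using pow_mat_commute[OF A A] by simp
  show ?thesis
  proof
    assume dr: "is_drazin_inverse A X"
    then have X: "X \<in> carrier_mat n n" and XAX: "X * A * X = X" and AX: "A * X = X * A"
      and DAX: "D * A * X = D"
      unfolding is_drazin_inverse_def pow D_def[symmetric] using A by auto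
    have DX: "D * X = X * D" unfolding D_def using pow_mat_commute[OF A X AX] .
    have "X * A * D = A * (D * X)" unfolding AX[symmetric] DX using X A D by (simp add: assoc)
    also have "\<dots> = D * A * X" unfolding comm using X A D by (simp add: assoc)
    finally have XAD: "X * A * D = D" using DAX by simp
    have "(\<exists>Y \<in> carrier_mat n n. X = A ^\<^sub>m j * Y) \<and> (\<exists>Z \<in> carrier_mat n n. X = Z * A ^\<^sub>m j)" for j
    proof (induction j)
      case 0
      show ?case using X A by (auto intro!: bexI[of _ X])
    next
      case (Suc j)
      then obtain Y Z where Y: "Y \<in> carrier_mat n n" "X = A ^\<^sub>m j * Y"
        and Z: "Z \<in> carrier_mat n n" "X = Z * A ^\<^sub>m j" by blast
      have "X = A * X * X" unfolding AX XAX ..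
      also have "\<dots> = A * (A ^\<^sub>m j * Y) * X" by (simp only: Y(2)[symmetric])
      also have "\<dots> = (A * A ^\<^sub>m j) * (Y * X)" using A X Y(1) by (simp add: assoc)
      also have "A * A ^\<^sub>m j = A ^\<^sub>m Suc j" using pow_mat_commute[OF A A] by simp
      finally have "X = A ^\<^sub>m Suc j * (Y * X)" .
      moreover have "X = (X * Z) * A ^\<^sub>m Suc j"
      proof -
        have "X = X * X * A" using XAX X A by (simp add: assoc AX)
        also have "\<dots> = X * (Z * A ^\<^sub>m j) * A" by (simp only: Z(2)[symmetric])
        also have "\<dots> = (X * Z) * A ^\<^sub>m Suc j" using A X Z(1) by (simp add: assoc)
        finally show ?thesis .
      qed
      ultimately show ?case using X Y(1) Z(1) by (meson mult_carrier_mat)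
    qed
    then have "(\<exists>Y \<in> carrier_mat n n. X = D * Y) \<and> (\<exists>Z \<in> carrier_mat n n. X = Z * D)" unfolding D_def by blast
    then show "is_inverse_along A (A ^\<^sub>m mat_index A) X"
      unfolding is_inverse_along_def D_def[symmetric] using A X XAD DAX by auto
  next
    assume "is_inverse_along A (A ^\<^sub>m mat_index A) X"
    then have along: "is_inverse_along A D X" unfolding D_def .
    from along A obtain Y Z where X: "X \<in> carrier_mat n n" and XAD: "X * A * D = D" and DAX: "D * A * X = D"
      and Y: "Y \<in> carrier_mat n n" "X = D * Y" and Z: "Z \<in> carrier_mat n n" "X = Z * D"
      by (elim is_inverse_alongE)
    have "A * X = D * A * Y" unfolding comm Y(2) using A D Y(1) by (simp add: assoc)
    also have "\<dots> = X * A * D * A * Y" by (simp only: XAD)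
    also have "\<dots> = X * A * (D * A) * Y" using A D X Y(1) by (simp add: assoc)
    also have "\<dots> = X * A * A * (D * Y)" unfolding comm using A D X Y(1) by (simp add: assoc)
    finally have 1: "A * X = X * A * A * X" by (simp only: Y(2)[symmetric])
    have "X * A = Z * (A * D)" unfolding comm[symmetric] Z(2) using A D Z(1) by (simp add: assoc)
    also have "\<dots> = Z * (A * (D * A * X))" by (simp only: DAX)
    also have "\<dots> = Z * (A * D) * A * X" using A D X Z(1) by (simp add: assoc)
    also have "\<dots> = Z * D * A * A * X" unfolding comm[symmetric] using A D X Z(1) by (simp add: assoc)
    finally have 2: "X * A = X * A * A * X" by (simp only: Z(2)[symmetric])
    show "is_drazin_inverse A X"
      unfolding is_drazin_inverse_def pow D_def[symmetric]
      using A X 1 2 DAX is_inverse_along_outer[OF A D along] by auto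
  qed
qed


section \<open>The Minkowski inverse as the inverse along the Minkowski adjoint\<close>

lemma minkowski_metric_carrier: "minkowski_metric n \<in> carrier_mat n n"
  unfolding minkowski_metric_def by simp

lemma minkowski_metric_squared: "minkowski_metric n * minkowski_metric n = 1\<^sub>m n"
proof -
  have "(\<lambda>i::nat. (if i = 0 then 1 else - 1) * (if i = 0 then 1 else - 1)) = (\<lambda>i. 1 :: complex)"
    by auto
  then show ?thesis unfolding minkowski_metric_def by simp
qed

lemma mat_adjoint_minkowski_metric: "mat_adjoint (minkowski_metric n) = minkowski_metric n"
  using mat_adjoint_carrier[OF minkowski_metric_carrier[of n]]
  by (intro eq_matI) (auto simp: mat_adjoint_index minkowski_metric_def mat_diag_def)

lemma minkowski_adjoint_carrier:
  "A \<in> carrier_mat n n \<Longrightarrow> minkowski_adjoint A \<in> carrier_mat n n"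
  unfolding minkowski_adjoint_def
  by (auto intro!: mult_carrier_mat[of _ n n] mat_adjoint_carrier minkowski_metric_carrier)

lemma minkowski_adjoint_mult:
  assumes A: "A \<in> carrier_mat n n" and B: "B \<in> carrier_mat n n"
  shows "minkowski_adjoint (A * B) = minkowski_adjoint B * minkowski_adjoint A"
proof -
  note assoc = assoc_mult_mat[of _ n n _ n _ n] mult_carrier_mat[of _ n n _ n]
  let ?G = "minkowski_metric n"
  note G = minkowski_metric_carrier[of n]
  note adj = mat_adjoint_carrier[OF A] mat_adjoint_carrier[OF B]
  have "minkowski_adjoint B * minkowski_adjoint A
      = (?G * mat_adjoint B) * (?G * ?G) * (mat_adjoint A * ?G)"
    unfolding minkowski_adjoint_def using A B G adj by (simp add: assoc)
  also have "\<dots> = ?G * mat_adjoint B * mat_adjoint A * ?G"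
    unfolding minkowski_metric_squared using G adj by (simp add: assoc)
  also have "\<dots> = minkowski_adjoint (A * B)"
    unfolding minkowski_adjoint_def mat_adjoint_mult[OF A B] using A B G adj by (simp add: assoc)
  finally show ?thesis by simp
qed

lemma minkowski_adjoint_involution:
  assumes A: "A \<in> carrier_mat n n"
  shows "minkowski_adjoint (minkowski_adjoint A) = A"
proof -
  note assoc = assoc_mult_mat[of _ n n _ n _ n] mult_carrier_mat[of _ n n _ n]
  let ?G = "minkowski_metric n"
  note G = minkowski_metric_carrier[of n]
  note adj = mat_adjoint_carrier[OF A]
  have "mat_adjoint (?G * mat_adjoint A * ?G) = ?G * A * ?G"
    using mat_adjoint_mult[OF mult_carrier_mat[OF G adj] G] mat_adjoint_mult[OF G adj] G A
    by (simp add: mat_adjoint_minkowski_metric assoc)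
  moreover have "dim_row (?G * mat_adjoint A * ?G) = n" using G by simp
  ultimately have "minkowski_adjoint (minkowski_adjoint A) = ?G * (?G * A * ?G) * ?G"
    unfolding minkowski_adjoint_def using A by simp
  also have "\<dots> = (?G * ?G) * A * (?G * ?G)" using A G by (simp add: assoc)
  also have "\<dots> = A" unfolding minkowski_metric_squared using A by simp
  finally show ?thesis .
qed

lemma mat_rank_minkowski_adjoint:
  assumes A: "A \<in> carrier_mat n n"
  shows "mat_rank (minkowski_adjoint A) = mat_rank A"
proof -
  have le: "mat_rank (minkowski_adjoint B) \<le> mat_rank B" if B: "B \<in> carrier_mat n n" for B
  proof -
    let ?G = "minkowski_metric n"
    note G = minkowski_metric_carrier[of n] and adj = mat_adjoint_carrier[OF B]
    have "mat_rank (?G * mat_adjoint B * ?G) \<le> mat_rank (?G * mat_adjoint B)"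
      using mat_rank_mult_le(1)[OF mult_carrier_mat[OF G adj] G] .
    also have "\<dots> \<le> mat_rank (mat_adjoint B)" using mat_rank_mult_le(3)[OF G adj] .
    also have "\<dots> = mat_rank B" using mat_rank_adjoint[OF B] .
    finally show ?thesis unfolding minkowski_adjoint_def using B by simp
  qed
  show ?thesis
    using le[OF A] le[OF minkowski_adjoint_carrier[OF A]] minkowski_adjoint_involution[OF A] by simp
qed

text \<open>
  Write \<open>B\<close> for the Minkowski adjoint of \<open>A\<close> and \<open>X'\<close> for that of \<open>X\<close>.  The symmetry conditions say
  \<open>X' * B = A * X\<close> and \<open>B * X' = X * A\<close>; with them, the adjoint of \<open>A * X * A = A\<close> becomes both
  \<open>X * A * B = B\<close> and \<open>B * A * X = B\<close>.  In the other direction the adjoints of these two equations are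
  \<open>A * B * X' = A\<close> and \<open>X' * B * A = A\<close>, from which the symmetry conditions are recovered.
\<close>

lemma is_minkowski_inverse_iff_inverse_along:
  assumes A: "A \<in> carrier_mat n n"
  shows "is_minkowski_inverse A X \<longleftrightarrow> is_inverse_along A (minkowski_adjoint A) X"
proof -
  note assoc = assoc_mult_mat[of _ n n _ n _ n] mult_carrier_mat[of _ n n _ n]
  define B where "B = minkowski_adjoint A"
  have B: "B \<in> carrier_mat n n" unfolding B_def using minkowski_adjoint_carrier[OF A] .
  have B_adj: "minkowski_adjoint B = A" unfolding B_def using minkowski_adjoint_involution[OF A] .
  show ?thesis
  proof
    assume mi: "is_minkowski_inverse A X"
    then have X: "X \<in> carrier_mat n n" and AXA: "A * X * A = A" and XAX: "X * A * X = X"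
      and AX: "minkowski_adjoint (A * X) = A * X" and XA: "minkowski_adjoint (X * A) = X * A"
      unfolding is_minkowski_inverse_def using A by auto
    define X' where "X' = minkowski_adjoint X"
    have X': "X' \<in> carrier_mat n n" unfolding X'_def using minkowski_adjoint_carrier[OF X] .
    have AX': "X' * B = A * X" using AX minkowski_adjoint_mult[OF A X] unfolding X'_def B_def by simp
    have XA': "B * X' = X * A" using XA minkowski_adjoint_mult[OF X A] unfolding X'_def B_def by simp
    have BXB: "B * X' * B = B"
      using arg_cong[OF AXA, of minkowski_adjoint] minkowski_adjoint_mult[OF mult_carrier_mat[OF A X] A]
        minkowski_adjoint_mult[OF A X] A X B X' unfolding X'_def B_def by (simp add: assoc)
    have 1: "X * A * B = B" unfolding XA'[symmetric] using BXB .
    have 2: "B * A * X = B" using BXB A X B X' AX' by (simp add: assoc)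
    have "X = B * X' * X" unfolding XA' using XAX by simp
    then have 3: "X = B * (X' * X)" using X X' B by (simp add: assoc)
    have "X = X * (X' * B)" unfolding AX' using XAX X A by (simp add: assoc)
    then have 4: "X = (X * X') * B" using X X' B by (simp add: assoc)
    show "is_inverse_along A (minkowski_adjoint A) X"
      unfolding is_inverse_along_def B_def[symmetric]
      using A X 1 2 mult_carrier_mat[OF X' X] mult_carrier_mat[OF X X'] 3 4 by (metis carrier_matD(1))
  next
    assume "is_inverse_along A (minkowski_adjoint A) X"
    then have along: "is_inverse_along A B X" unfolding B_def .
    from along A have X: "X \<in> carrier_mat n n" and XAB: "X * A * B = B" and BAX: "B * A * X = B"
      by (auto elim: is_inverse_alongE)
    define X' where "X' = minkowski_adjoint X"
    have X': "X' \<in> carrier_mat n n" unfolding X'_def using minkowski_adjoint_carrier[OF X] .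
    have X'BA: "X' * B * A = A"
      using arg_cong[OF BAX, of minkowski_adjoint] minkowski_adjoint_mult[OF mult_carrier_mat[OF B A] X]
        minkowski_adjoint_mult[OF B A] A B X' unfolding X'_def B_adj B_def[symmetric] by (simp add: assoc)
    have ABX': "A * B * X' = A"
      using arg_cong[OF XAB, of minkowski_adjoint] minkowski_adjoint_mult[OF mult_carrier_mat[OF X A] B]
        minkowski_adjoint_mult[OF X A] A B X' unfolding X'_def B_adj B_def[symmetric] by (simp add: assoc)
    have "X' * B = X' * (B * A * X)" by (simp only: BAX)
    also have "\<dots> = X' * B * A * X" using A B X X' by (simp add: assoc)
    finally have AX: "X' * B = A * X" by (simp only: X'BA)
    have "B * X' = X * A * B * X'" by (simp only: XAB)
    also have "\<dots> = X * (A * B * X')" using A B X X' by (simp add: assoc)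
    finally have XA: "B * X' = X * A" by (simp only: ABX')
    have "minkowski_adjoint (A * X) = A * X"
      unfolding minkowski_adjoint_mult[OF A X] X'_def[symmetric] B_def[symmetric] AX ..
    moreover have "minkowski_adjoint (X * A) = X * A"
      unfolding minkowski_adjoint_mult[OF X A] X'_def[symmetric] B_def[symmetric] XA ..
    moreover have "A * X * A = A" unfolding AX[symmetric] X'BA ..
    ultimately show "is_minkowski_inverse A X"
      unfolding is_minkowski_inverse_def using A X is_inverse_along_outer[OF A B along] by simp
  qed
qed

section \<open>Existence of the two inverses\<close>

lemma is_drazin_inverse_drazin_inverse:
  assumes A: "A \<in> carrier_mat n n"
  shows "is_drazin_inverse A (drazin_inverse A)"
proof -
  have D: "A ^\<^sub>m mat_index A \<in> carrier_mat n n" using A by simp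
  have "\<exists>!X. is_drazin_inverse A X"
    unfolding is_drazin_inverse_iff_inverse_along[OF A]
    using is_inverse_along_exists[OF A D rank_sandwiched_by_index_power[OF A]]
      is_inverse_along_unique[OF A D] by blast
  then show ?thesis unfolding drazin_inverse_def by (rule theI')
qed

text \<open>
  The adjoint has the rank of \<open>A\<close>, so the assumption is exactly the existence criterion for the inverse
  of \<open>A\<close> along its Minkowski adjoint.
\<close>

lemma is_minkowski_inverse_minkowski_inverse:
  assumes A: "A \<in> carrier_mat n n"
    and rank: "mat_rank (minkowski_adjoint A * A * minkowski_adjoint A) = mat_rank A"
  shows "is_minkowski_inverse A (minkowski_inverse A)"
proof -
  note B = minkowski_adjoint_carrier[OF A]
  have "\<exists>!X. is_minkowski_inverse A X"
    unfolding is_minkowski_inverse_iff_inverse_along[OF A]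
    using is_inverse_along_exists[OF A B] rank mat_rank_minkowski_adjoint[OF A]
      is_inverse_along_unique[OF A B] by metis
  then show ?thesis unfolding minkowski_inverse_def by (rule theI')
qed

section \<open>Idempotents and projectors\<close>

lemma eq_mat_if_eq_mult_mat_vec:
  fixes P Q :: "complex mat"
  assumes P: "P \<in> carrier_mat n m" and Q: "Q \<in> carrier_mat n m"
    and eq: "\<And>v. v \<in> carrier_vec m \<Longrightarrow> P *\<^sub>v v = Q *\<^sub>v v"
  shows "P = Q"
proof (rule mat_col_eqI)
  have col: "R *\<^sub>v unit_vec m j = col R j" if "R \<in> carrier_mat n m" "j < m" for R :: "complex mat" and j
    using that by (intro eq_vecI) auto
  show "col P j = col Q j" if "j < dim_col Q" for j
    using col[OF P, of j] col[OF Q, of j] eq[OF unit_vec_carrier[of m j]] that Q by simp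
qed (use P Q in auto)

lemma complementary_range_kernel_idempotent:
  assumes P: "P \<in> carrier_mat n n" and idem: "P * P = P"
  shows "complementary_subspaces n (mat_range P) (mat_kernel P)"
proof -
  interpret K: kernel n n P using P by unfold_locales
  have PP: "P *\<^sub>v (P *\<^sub>v v) = P *\<^sub>v v" if "v \<in> carrier_vec n" for v
    using assoc_mult_mat_vec[OF P P that] idem by simp
  have "VectorSpace.subspace class_ring (mat_range P) (module_vec TYPE(complex) n)"
    unfolding mat_range_eq_span[OF P] using K.NC.span_is_subspace[of "set (cols P)"] P cols_dim[of P] by auto
  moreover have "VectorSpace.subspace class_ring (mat_kernel P) (module_vec TYPE(complex) n)"
  proof (rule subspace.intro)
    show "vectorspace class_ring (module_vec TYPE(complex) n)" by (rule K.NC.vectorspace_axioms)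
    show "submodule class_ring (mat_kernel P) (module_vec TYPE(complex) n)"
      using P by unfold_locales
        (auto simp: mat_kernel[OF P] mult_add_distrib_mat_vec[OF P] mult_mat_vec[OF P])
  qed
  moreover have "mat_range P \<inter> mat_kernel P = {0\<^sub>v n}"
  proof
    show "mat_range P \<inter> mat_kernel P \<subseteq> {0\<^sub>v n}"
    proof
      fix w assume w: "w \<in> mat_range P \<inter> mat_kernel P"
      then obtain v where "v \<in> carrier_vec n" "w = P *\<^sub>v v" using P unfolding mat_range_def by auto
      then show "w \<in> {0\<^sub>v n}" using PP mat_kernelD(2)[OF P, of w] w by simp
    qed
    have "P *\<^sub>v 0\<^sub>v n = 0\<^sub>v n" using P by auto
    then show "{0\<^sub>v n} \<subseteq> mat_range P \<inter> mat_kernel P"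
      using P unfolding mat_range_def by (auto intro!: mat_kernelI image_eqI[of _ _ "0\<^sub>v n"])
  qed
  moreover have "{s + t | s t. s \<in> mat_range P \<and> t \<in> mat_kernel P} = carrier_vec n"
  proof
    show "{s + t | s t. s \<in> mat_range P \<and> t \<in> mat_kernel P} \<subseteq> carrier_vec n"
      using P mat_kernelD(1)[OF P] unfolding mat_range_def by auto
    show "carrier_vec n \<subseteq> {s + t | s t. s \<in> mat_range P \<and> t \<in> mat_kernel P}"
    proof
      fix v :: "complex vec" assume v: "v \<in> carrier_vec n"
      have Pv: "P *\<^sub>v v \<in> carrier_vec n" using P v by simp
      have "v - P *\<^sub>v v \<in> mat_kernel P"
        using v Pv PP[OF v] mult_minus_distrib_mat_vec[OF P v Pv] by (intro mat_kernelI[OF P]) auto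
      moreover have "P *\<^sub>v v \<in> mat_range P" using v P unfolding mat_range_def by auto
      moreover have "v = P *\<^sub>v v + (v - P *\<^sub>v v)" by (rule eq_vecI) (use v Pv P in \<open>auto simp del: index_mult_mat_vec\<close>)
      ultimately show "v \<in> {s + t | s t. s \<in> mat_range P \<and> t \<in> mat_kernel P}" by blast
    qed
  qed
  ultimately show ?thesis unfolding complementary_subspaces_def by blast
qed

text \<open>
  Any competing idempotent \<open>Q\<close> agrees with \<open>P\<close>: it kills \<open>v - P *\<^sub>v v\<close>, which lies in the common
  null space, and it fixes \<open>P *\<^sub>v v\<close>, which lies in the common range.
\<close>

lemma projector_range_kernel_idempotent:
  assumes P: "P \<in> carrier_mat n n" and idem: "P * P = P"
  shows "projector n (mat_range P) (mat_kernel P) = P"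
  unfolding projector_def
proof (rule the_equality)
  show "P \<in> carrier_mat n n \<and> P * P = P \<and> mat_range P = mat_range P \<and> mat_kernel P = mat_kernel P"
    using assms by simp
next
  fix Q assume "Q \<in> carrier_mat n n \<and> Q * Q = Q \<and> mat_range Q = mat_range P \<and> mat_kernel Q = mat_kernel P"
  then have Q: "Q \<in> carrier_mat n n" and idemQ: "Q * Q = Q"
    and rng: "mat_range Q = mat_range P" and ker: "mat_kernel Q = mat_kernel P" by auto
  show "Q = P"
  proof (rule eq_mat_if_eq_mult_mat_vec[OF Q P])
    fix v :: "complex vec" assume v: "v \<in> carrier_vec n"
    have Pv: "P *\<^sub>v v \<in> carrier_vec n" using P v by simp
    have "P *\<^sub>v (P *\<^sub>v v) = P *\<^sub>v v" using assoc_mult_mat_vec[OF P P v] idem by simp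
    then have "v - P *\<^sub>v v \<in> mat_kernel Q" unfolding ker
      using v Pv mult_minus_distrib_mat_vec[OF P v Pv] by (intro mat_kernelI[OF P]) auto
    then have diff: "Q *\<^sub>v v - Q *\<^sub>v (P *\<^sub>v v) = 0\<^sub>v n"
      using mat_kernelD(2)[OF Q] mult_minus_distrib_mat_vec[OF Q v Pv] by simp
    have Qv: "Q *\<^sub>v v = Q *\<^sub>v (P *\<^sub>v v)"
    proof (rule eq_vecI)
      fix i assume i: "i < dim_vec (Q *\<^sub>v (P *\<^sub>v v))"
      show "(Q *\<^sub>v v) $ i = (Q *\<^sub>v (P *\<^sub>v v)) $ i"
        using arg_cong[OF diff, of "\<lambda>w. w $ i"] i Q by (simp del: index_mult_mat_vec)
    qed simp
    have "P *\<^sub>v v \<in> mat_range Q" using rng v P unfolding mat_range_def by auto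
    then obtain u where u: "u \<in> carrier_vec n" "P *\<^sub>v v = Q *\<^sub>v u" using Q unfolding mat_range_def by auto
    show "Q *\<^sub>v v = P *\<^sub>v v"
      unfolding Qv u(2) using assoc_mult_mat_vec[OF Q Q u(1)] idemQ by simp
  qed
qed

section \<open>Characterization of the m-DMP inverse\<close>

theorem theorem3p9:
  fixes A :: "complex mat" and n k :: nat
  assumes "A \<in> carrier_mat n n"
    and "mat_index A = k"
    and "mat_rank (minkowski_adjoint A * A * minkowski_adjoint A) = mat_rank A"
  shows "complementary_subspaces n (mat_range (A ^\<^sub>m k)) (mat_kernel (A ^\<^sub>m k * minkowski_inverse A)) \<and>
    m_DMP_inverse A \<in> carrier_mat n n \<and>
    (\<forall>X \<in> carrier_mat n n.
       (A * X = projector n (mat_range (A ^\<^sub>m k)) (mat_kernel (A ^\<^sub>m k * minkowski_inverse A)) \<and>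
        mat_range X \<subseteq> mat_range (A ^\<^sub>m k))
       \<longleftrightarrow> X = m_DMP_inverse A)"
proof -
  note A = assms(1) and assoc = assoc_mult_mat[of _ n n _ n _ n] mult_carrier_mat[of _ n n _ n]
  define D where "D = A ^\<^sub>m k"
  define E where "E = drazin_inverse A"
  define M where "M = minkowski_inverse A"
  have D: "D \<in> carrier_mat n n" unfolding D_def using A by simp
  have dr: "is_drazin_inverse A E" unfolding E_def using is_drazin_inverse_drazin_inverse[OF A] .
  then have E: "E \<in> carrier_mat n n" and EAE: "E * A * E = E" and AE: "A * E = E * A"
    unfolding is_drazin_inverse_def using A by auto
  have along: "is_inverse_along A D E"
    using dr is_drazin_inverse_iff_inverse_along[OF A] assms(2) unfolding D_def by simp
  from along A obtain Y Z where EAD: "E * A * D = D" and DAE: "D * A * E = D"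
    and Y: "Y \<in> carrier_mat n n" "E = D * Y" and Z: "Z \<in> carrier_mat n n" "E = Z * D"
    by (elim is_inverse_alongE)
  have M: "M \<in> carrier_mat n n" and AMA: "A * M * A = A"
    using is_minkowski_inverse_minkowski_inverse[OF A assms(3)] A
    unfolding is_minkowski_inverse_def M_def by auto
  define X0 where "X0 = E * A * M"
  define P where "P = A * X0"
  have X0: "X0 \<in> carrier_mat n n" and P: "P \<in> carrier_mat n n"
    unfolding X0_def P_def using A E M by auto
  have P_left: "P = D * (Y * A * A * M)"
  proof -
    have "P = A * E * A * M" unfolding P_def X0_def using A E M by (simp add: assoc)
    also have "\<dots> = D * Y * A * A * M" by (simp only: AE Y(2)[symmetric])
    finally show ?thesis using A D Y(1) M by (simp add: assoc)
  qed
  have P_right: "P = (A * A * Z) * (D * M)"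
  proof -
    have "P = A * (E * A) * M" unfolding P_def X0_def using A E M by (simp add: assoc)
    also have "\<dots> = A * (A * (Z * D)) * M" unfolding AE[symmetric] Z(2)[symmetric] ..
    finally show ?thesis using A D Z(1) M by (simp add: assoc)
  qed
  have AMD: "A * M * D = D"
  proof -
    \<comment> \<open>\<open>A * M\<close> fixes every product with left factor \<open>A\<close>; \<open>A * (E * D)\<close> exhibits \<open>D\<close> as one, also for exponent \<open>0\<close>.\<close>
    have "E * A * D = A * (E * D)" unfolding AE[symmetric] using A E D by (simp add: assoc)
    then have D_eq: "A * (E * D) = D" using EAD by simp
    then have "A * M * D = A * M * (A * (E * D))" by simp
    also have "\<dots> = A * M * A * (E * D)" using A M E D by (simp add: assoc)
    also have "\<dots> = D" unfolding AMA using D_eq by simp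
    finally show ?thesis .
  qed
  have PD: "P * D = D"
  proof -
    have "P * D = A * E * (A * M * D)" unfolding P_def X0_def using A E M D by (simp add: assoc)
    then show ?thesis unfolding AMD AE EAD .
  qed
  have DM: "D * M = D * E * P"
  proof -
    have "D * E * P = D * (E * A * E) * A * M" unfolding P_def X0_def using A D E M by (simp add: assoc)
    also have "\<dots> = D * (E * A) * M" unfolding EAE using A D E M by (simp add: assoc)
    also have "\<dots> = D * A * E * M" unfolding AE[symmetric] using A D E M by (simp add: assoc)
    finally show ?thesis unfolding DAE by simp
  qed
  have EP: "E * P = X0"
  proof -
    have "E * P = E * A * E * A * M" unfolding P_def X0_def using A E M by (simp add: assoc)
    then show ?thesis unfolding EAE X0_def .
  qed
  have W: "Y * A * A * M \<in> carrier_mat n n" and DMc: "D * M \<in> carrier_mat n n"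
    using A D Y(1) M by auto
  have "P * P = P * D * (Y * A * A * M)" using P_left assoc(1)[OF P D W] by simp
  then have idem: "P * P = P" unfolding PD using P_left by simp
  have rng: "mat_range P = mat_range D"
    using mat_range_mult_subset[OF D W] mat_range_mult_subset[OF P D] unfolding PD P_left[symmetric] by simp
  have ker: "mat_kernel P = mat_kernel (D * M)"
    using mat_kernel_mult_subset[OF DMc, of "A * A * Z" n] mat_kernel_mult_subset[OF P, of "D * E" n]
      A D E Z(1) unfolding DM[symmetric] P_right[symmetric] by auto
  have proj: "projector n (mat_range D) (mat_kernel (D * M)) = P"
    using projector_range_kernel_idempotent[OF P idem] unfolding rng ker .
  have char: "A * X = P \<and> mat_range X \<subseteq> mat_range D \<longleftrightarrow> X = X0" if X: "X \<in> carrier_mat n n" for X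
  proof
    assume h: "A * X = P \<and> mat_range X \<subseteq> mat_range D"
    then obtain F where F: "F \<in> carrier_mat n n" "X = D * F" using range_subset_imp_factor[OF X D] by blast
    have "X = E * A * D * F" unfolding EAD using F(2) .
    also have "\<dots> = E * (A * (D * F))" using A D E F(1) by (simp add: assoc)
    also have "\<dots> = X0" unfolding F(2)[symmetric] using h EP by simp
    finally show "X = X0" .
  next
    assume X_eq: "X = X0"
    have "X0 = D * (Y * A * M)" unfolding X0_def Y(2) using A D Y(1) M by (simp add: assoc)
    then have "mat_range X0 \<subseteq> mat_range D"
      using mat_range_mult_subset[OF D, of "Y * A * M" n] A Y(1) M by simp
    then show "A * X = P \<and> mat_range X \<subseteq> mat_range D" using X_eq P_def by simp
  qed
  have "m_DMP_inverse A = X0" unfolding m_DMP_inverse_def X0_def E_def M_def ..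
  then show ?thesis
    using complementary_range_kernel_idempotent[OF P idem] X0 char
    unfolding rng ker D_def[symmetric] M_def[symmetric] proj by simp
qed

end
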